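(* For any $1<t<3/2$, the operator $K_{2t}:L^\infty(\mathbb D)\to L^{\frac{1}{2t-2},\infty}(\mathbb D)$ is bounded, where $$K_{2t}f(z):=\int_{\mathbb D}\frac{f(w)}{(1-z\overline w)^{2t}}\,dA(w),\qquad z\in\mathbb D.$$
   Context: $\mathbb D$ is the open unit disc in $\mathbb C$, $dA$ is normalized area measure on $\mathbb D$, $|E|$ is the $dA$-measure of $E$, and $\|f\|_{L^{q,\infty}(\mathbb D)}:=\sup_{\lambda>0}\lambda|\{z\in\mathbb D:|f(z)|>\lambda\}|^{1/q}$. *)

theory Defs
  imports "HOL-Analysis.Analysis" "HOL-Probability.Essential_Supremum"
begin

text \<open>Lebesgue measure on the open unit disc (with its Lebesgue-measurable sets), scaled so that
  the disc has measure one.\<close>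

definition disc_area :: "complex measure" where
  "disc_area = density (lebesgue_on (ball 0 1)) (\<lambda>_. ennreal (1 / pi))"

text \<open>Function spaces are represented by sets of functions rather than by sets of a.e.\ equivalence
  classes, and the (quasi-)norms take values in the extended reals. Only the values of a function
  on \<open>space M\<close> matter.\<close>

definition Linf_norm :: "'a measure \<Rightarrow> ('a \<Rightarrow> complex) \<Rightarrow> ereal" where
  "Linf_norm M f = esssup M (\<lambda>x. ereal (norm (f x)))"

definition Linf :: "'a measure \<Rightarrow> ('a \<Rightarrow> complex) set" where
  "Linf M = {f \<in> borel_measurable M. Linf_norm M f < \<infinity>}"

text \<open>The real-valued \<open>measure\<close> is appropriate here only for finite measures \<open>M\<close>, such as
  \<open>disc_area\<close>.\<close>

definition weak_Lp_norm :: "real \<Rightarrow> 'a measure \<Rightarrow> ('a \<Rightarrow> complex) \<Rightarrow> ereal" where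
  "weak_Lp_norm q M f =
     (SUP l\<in>{0<..}. ereal (l * measure M {x \<in> space M. norm (f x) > l} powr (1 / q)))"

definition weak_Lp :: "real \<Rightarrow> 'a measure \<Rightarrow> ('a \<Rightarrow> complex) set" where
  "weak_Lp q M = {f \<in> borel_measurable M. weak_Lp_norm q M f < \<infinity>}"

text \<open>A bounded linear operator between two function spaces over \<open>M\<close>, given by their carriers
  \<open>X\<close>, \<open>Y\<close> and (quasi-)norms \<open>NX\<close>, \<open>NY\<close>. Linearity is required up to null sets; together with the
  norm estimate it makes \<open>T\<close> well defined on a.e.\ equivalence classes.\<close>

definition bounded_operator ::
  "'a measure \<Rightarrow> ('a \<Rightarrow> complex) set \<Rightarrow> (('a \<Rightarrow> complex) \<Rightarrow> ereal)
     \<Rightarrow> ('a \<Rightarrow> complex) set \<Rightarrow> (('a \<Rightarrow> complex) \<Rightarrow> ereal)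
     \<Rightarrow> (('a \<Rightarrow> complex) \<Rightarrow> ('a \<Rightarrow> complex)) \<Rightarrow> bool" where
  "bounded_operator M X NX Y NY T \<longleftrightarrow>
     (\<forall>f\<in>X. T f \<in> Y) \<and>
     (\<forall>f\<in>X. \<forall>g\<in>X. AE x in M. T (\<lambda>y. f y + g y) x = T f x + T g x) \<and>
     (\<forall>f\<in>X. \<forall>c. AE x in M. T (\<lambda>y. c * f y) x = c * T f x) \<and>
     (\<exists>C::real. 0 \<le> C \<and> (\<forall>f\<in>X. NY (T f) \<le> ereal C * NX f))"

text \<open>For \<open>z\<close>, \<open>w\<close> in the disc, \<open>1 - z * cnj w\<close> has positive real part, so the complex power
  (\<open>powr\<close> uses the principal logarithm) is the usual holomorphic branch.\<close>

definition K_integrand :: "real \<Rightarrow> (complex \<Rightarrow> complex) \<Rightarrow> complex \<Rightarrow> complex \<Rightarrow> complex" where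
  "K_integrand a f z w = f w / (1 - z * cnj w) powr (complex_of_real a)"

definition K_op :: "real \<Rightarrow> (complex \<Rightarrow> complex) \<Rightarrow> complex \<Rightarrow> complex" where
  "K_op a f z = (\<integral>w. K_integrand a f z w \<partial>disc_area)"

end

theory Submission
  imports Defs "HOL-Probability.Probability_Measure"
begin

text \<open>
  The estimate comes from the size of the kernel alone, without cancellation. Write \<open>s = 2 * t\<close>, so that \<open>s > 2\<close>. For fixed \<open>z\<close> in
  the disc the function \<open>w \<mapsto> \<bar>1 - z * cnj w\<bar>\<close> is at least \<open>\<delta> = 1 - \<bar>z\<bar>\<close>, and its sublevel set at
  height \<open>r\<close> has area at most \<open>4 * r\<^sup>2\<close>, because for \<open>\<bar>z\<bar> \<ge> 1 / 2\<close> it lies in the disc of radius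
  \<open>2 * r\<close> around the reflected point \<open>1 / cnj z\<close>, while for smaller \<open>\<bar>z\<bar>\<close> it is empty unless \<open>r\<close> is so
  large that the bound is trivial (\<open>emeasure_kernel_sublevel_le\<close>). Slicing dyadically, the level \<open>2 ^ k * \<delta>\<close> contributes at most a constant times \<open>(2 ^ k * \<delta>) powr (2 - s)\<close> to
  \<open>\<integral> \<bar>1 - z * cnj w\<bar> powr (-s) dA(w)\<close>. Since \<open>s > 2\<close>, these contributions form a convergent
  geometric series (\<open>nn_integral_negative_powr_le\<close>), whence the
  pointwise bound \<open>\<bar>K f z\<bar> \<le> C * \<parallel>f\<parallel> * (1 - \<bar>z\<bar>) powr (2 - s)\<close> with the essential supremum norm \<open>\<parallel>f\<parallel>\<close>.

  The right-hand side is in weak \<open>L\<close> with exponent \<open>1 / (s - 2)\<close>: it exceeds \<open>\<lambda>\<close> only on a boundary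
  strip \<open>1 - \<bar>z\<bar> < \<rho>\<close> with \<open>\<rho> powr (s - 2) = C * \<parallel>f\<parallel> / \<lambda>\<close>, and the area of such a strip is at most
  \<open>2 * \<rho>\<close> (\<open>weak_Lp_norm_le_of_boundary_growth\<close>).
\<close>

section \<open>Normalized area on the disc\<close>

lemma space_disc_area [simp]: "space disc_area = ball 0 1"
  by (simp add: disc_area_def space_restrict_space)

lemma sets_disc_area: "sets disc_area = sets (lebesgue_on (ball 0 1))"
  by (simp add: disc_area_def)

lemma borel_imp_sets_disc_area:
  assumes "A \<in> sets borel" "A \<subseteq> ball 0 1"
  shows "A \<in> sets disc_area"
  using assms by (auto simp: sets_disc_area sets_restrict_space_iff)

lemma borel_measurable_disc_area:
  assumes "g \<in> borel_measurable borel"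
  shows "g \<in> borel_measurable disc_area"
proof -
  have "g \<in> borel_measurable (lebesgue_on (ball 0 1))"
    using assms by (intro measurable_restrict_space1 measurable_completion) simp
  then show ?thesis
    using measurable_cong_sets[OF sets_disc_area refl] by blast
qed

lemma emeasure_disc_area:
  assumes "A \<in> sets borel"
  shows "emeasure disc_area (A \<inter> ball 0 1) = ennreal (1 / pi) * emeasure lborel (A \<inter> ball 0 1)"
proof -
  have "A \<inter> ball 0 1 \<in> sets (lebesgue_on (ball 0 1))"
    using assms borel_imp_sets_disc_area[of "A \<inter> ball 0 1"] by (simp add: sets_disc_area)
  then show ?thesis
    using assms by (simp add: disc_area_def emeasure_density_const emeasure_restrict_space)
qed

lemma emeasure_disc_area_ball_le:
  assumes "0 \<le> r"
  shows "emeasure disc_area (ball c r \<inter> ball 0 1) \<le> ennreal (r\<^sup>2)"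
proof -
  have "emeasure disc_area (ball c r \<inter> ball 0 1)
      \<le> ennreal (1 / pi) * emeasure lborel (ball c r)"
    by (subst emeasure_disc_area) (auto intro!: mult_left_mono emeasure_mono)
  also have "\<dots> = ennreal (r\<^sup>2)"
    using assms by (simp add: emeasure_ball unit_ball_vol_2 flip: ennreal_mult)
  finally show ?thesis .
qed

lemma prob_space_disc_area: "prob_space disc_area"
proof
  have "emeasure disc_area (UNIV \<inter> ball 0 1) = 1"
    by (subst emeasure_disc_area) (simp_all add: emeasure_ball unit_ball_vol_2 flip: ennreal_mult)
  then show "emeasure disc_area (space disc_area) = 1" by simp
qed

interpretation disc_area: prob_space disc_area
  by (rule prob_space_disc_area)

lemma measure_disc_area_boundary_strip_le:
  assumes "0 \<le> \<rho>"
  shows "measure disc_area {z \<in> ball 0 1. 1 - norm z < \<rho>} \<le> 2 * \<rho>"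
proof (cases "\<rho> \<le> 1")
  case True
  have "emeasure disc_area (cball 0 (1 - \<rho>) \<inter> ball 0 1) = ennreal ((1 - \<rho>)\<^sup>2)"
  proof (cases "\<rho> = 0")
    case True
    have "cball 0 1 \<inter> ball (0::complex) 1 = space disc_area" by auto
    with True show ?thesis using disc_area.emeasure_space_1 by simp
  next
    case False
    then have "cball 0 (1 - \<rho>) \<inter> ball 0 1 = cball (0::complex) (1 - \<rho>)"
      using assms by auto
    then show ?thesis
      using emeasure_disc_area[of "cball 0 (1 - \<rho>)"] True
      by (simp add: emeasure_cball unit_ball_vol_2 flip: ennreal_mult)
  qed
  then have "measure disc_area (cball 0 (1 - \<rho>) \<inter> ball 0 1) = (1 - \<rho>)\<^sup>2"
    by (simp add: measure_def)
  moreover have "{z \<in> ball 0 1. 1 - norm z < \<rho>}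
      = space disc_area - (cball (0::complex) (1 - \<rho>) \<inter> ball 0 1)"
    by auto
  moreover have "cball 0 (1 - \<rho>) \<inter> ball 0 1 \<in> sets disc_area"
    by (rule borel_imp_sets_disc_area) auto
  ultimately have "measure disc_area {z \<in> ball 0 1. 1 - norm z < \<rho>} = 1 - (1 - \<rho>)\<^sup>2"
    using disc_area.prob_compl by metis
  also have "\<dots> = 2 * \<rho> - \<rho>\<^sup>2" by (simp add: power2_eq_square algebra_simps)
  also have "\<dots> \<le> 2 * \<rho>" by simp
  finally show ?thesis .
next
  case False
  then show ?thesis using disc_area.prob_le_1 by (smt (verit))
qed

section \<open>The kernel\<close>

lemma norm_one_minus_mult_cnj_ge:
  assumes "z \<in> ball 0 1" "w \<in> ball 0 1"
  shows "1 - norm z \<le> norm (1 - z * cnj w)"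
proof -
  have "norm (z * cnj w) \<le> norm z"
    using assms by (simp add: norm_mult mult_left_le)
  then show ?thesis using norm_triangle_ineq2[of 1 "z * cnj w"] by simp
qed

text \<open>Keeps the base of the complex power away from the branch cut, so that the power is continuous.\<close>

lemma Re_one_minus_mult_cnj_pos:
  assumes "z \<in> ball 0 1" "w \<in> ball 0 1"
  shows "0 < Re (1 - z * cnj w)"
proof -
  have "norm (z * cnj w) < 1 * 1"
    unfolding norm_mult using assms by (intro mult_strict_mono') auto
  then show ?thesis using complex_Re_le_cmod[of "z * cnj w"] by simp
qed

text \<open>For \<open>\<bar>z\<bar> \<ge> 1 / 2\<close> factor \<open>\<bar>1 - z * cnj w\<bar> = \<bar>z\<bar> * \<bar>1 / cnj z - w\<bar>\<close>, so that the sublevel set lies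
  in a disc of radius \<open>2 * r\<close>. For smaller \<open>\<bar>z\<bar>\<close> this disc would be too large, but then the sublevel
  set is empty unless \<open>r > 1 / 2\<close>, when the bound exceeds the total mass.\<close>

lemma emeasure_kernel_sublevel_le:
  assumes z: "z \<in> ball 0 1" and r: "0 < r"
  shows "emeasure disc_area {w \<in> space disc_area. norm (1 - z * cnj w) < r} \<le> ennreal (4 * r\<^sup>2)"
proof (cases "norm z < 1 / 2")
  case True
  show ?thesis
  proof (cases "r \<le> 1 / 2")
    case True
    have "1 / 2 \<le> norm (1 - z * cnj w)" if "w \<in> ball 0 1" for w
      using norm_one_minus_mult_cnj_ge[OF z that] \<open>norm z < 1 / 2\<close> by linarith
    then have "{w \<in> space disc_area. norm (1 - z * cnj w) < r} = {}"
      using True by fastforce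
    then show ?thesis by (metis emeasure_empty zero_le)
  next
    case False
    then have "1 \<le> 4 * r\<^sup>2"
      using power_mono[of "1 / 2" r 2] by (simp add: power2_eq_square)
    then have "1 \<le> ennreal (4 * r\<^sup>2)" by simp
    then show ?thesis using disc_area.emeasure_le_1 order_trans by blast
  qed
next
  case False
  then have z0: "z \<noteq> 0" by auto
  have "{w \<in> space disc_area. norm (1 - z * cnj w) < r} \<subseteq> ball (1 / cnj z) (2 * r) \<inter> ball 0 1"
  proof
    fix w assume "w \<in> {w \<in> space disc_area. norm (1 - z * cnj w) < r}"
    then have w: "norm (1 - z * cnj w) < r" "w \<in> ball 0 1" by simp_all
    have "norm (1 - z * cnj w) = norm (cnj (1 - z * cnj w))"
      by (rule complex_mod_cnj[symmetric])
    also have "\<dots> = norm (cnj z * (1 / cnj z - w))"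
      using z0 by (simp add: algebra_simps)
    also have "\<dots> = norm z * dist (1 / cnj z) w"
      by (simp add: norm_mult dist_norm)
    finally have "norm z * dist (1 / cnj z) w < r" using w by simp
    moreover have "1 / 2 * dist (1 / cnj z) w \<le> norm z * dist (1 / cnj z) w"
      using False by (intro mult_right_mono) auto
    ultimately have "dist (1 / cnj z) w < 2 * r" by linarith
    then show "w \<in> ball (1 / cnj z) (2 * r) \<inter> ball 0 1" using w by simp
  qed
  then have "emeasure disc_area {w \<in> space disc_area. norm (1 - z * cnj w) < r}
      \<le> emeasure disc_area (ball (1 / cnj z) (2 * r) \<inter> ball 0 1)"
    by (rule emeasure_mono) (rule borel_imp_sets_disc_area, auto)
  also have "\<dots> \<le> ennreal ((2 * r)\<^sup>2)"
    using r by (intro emeasure_disc_area_ball_le) simp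
  finally show ?thesis by (simp add: power_mult_distrib)
qed

text \<open>A layer-cake estimate: on the dyadic layer where \<open>h\<close> lies between \<open>2 ^ k * \<delta>\<close> and
  \<open>2 ^ Suc k * \<delta>\<close>, the integrand is at most \<open>(2 ^ k * \<delta>) powr (-s)\<close> and the measure at most
  \<open>A * (2 ^ Suc k * \<delta>) powr d\<close>. The products are geometric in \<open>k\<close> with ratio \<open>2 powr (d - s) < 1\<close>.\<close>

lemma nn_integral_negative_powr_le:
  fixes h :: "'a \<Rightarrow> real"
  assumes [measurable]: "h \<in> borel_measurable M"
    and \<delta>: "0 < \<delta>" and lower: "\<And>x. x \<in> space M \<Longrightarrow> \<delta> \<le> h x"
    and A: "0 \<le> A" and growth: "\<And>r. 0 < r \<Longrightarrow> emeasure M {x \<in> space M. h x < r} \<le> ennreal (A * r powr d)"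
    and s: "0 < s" "d < s"
  shows "(\<integral>\<^sup>+x. ennreal (h x powr (-s)) \<partial>M)
    \<le> ennreal (A * 2 powr d / (1 - 2 powr (d - s)) * \<delta> powr (d - s))"
proof -
  define a where "a k = (2 ^ k * \<delta>) powr (-s)" for k :: nat
  \<comment> \<open>Whole sublevel sets rather than disjoint layers: the growth hypothesis applies to them directly,
    and the overlap costs nothing in an upper bound by a sum of nonnegative terms.\<close>
  define E where "E k = {x \<in> space M. h x < 2 ^ Suc k * \<delta>}" for k :: nat
  define q :: real where "q = 2 powr (d - s)"
  have q: "0 < q" "q < 1" using s by (auto simp: q_def powr_less_one)
  have [measurable]: "E k \<in> sets M" for k unfolding E_def by measurable
  have "(\<integral>\<^sup>+x. ennreal (h x powr (-s)) \<partial>M)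
      \<le> (\<integral>\<^sup>+x. (\<Sum>k. ennreal (a k) * indicator (E k) x) \<partial>M)"
  proof (rule nn_integral_mono)
    fix x assume x: "x \<in> space M"
    \<comment> \<open>The index of the layer that contains \<open>x\<close>; a single term of the series suffices.\<close>
    define m where "m = nat \<lfloor>log 2 (h x / \<delta>)\<rfloor>"
    have h: "1 \<le> h x / \<delta>" using lower[OF x] \<delta> by simp
    then have "0 \<le> log 2 (h x / \<delta>)" by simp
    then have m: "real m \<le> log 2 (h x / \<delta>)" "log 2 (h x / \<delta>) < real m + 1"
      by (simp_all add: m_def)
    have "2 powr real m \<le> h x / \<delta>" "h x / \<delta> < 2 powr (real m + 1)"
      using m h le_log_iff[of 2 "h x / \<delta>" "real m"] log_less_iff[of 2 "h x / \<delta>" "real m + 1"] by simp_all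
    then have m': "2 ^ m * \<delta> \<le> h x" "h x < 2 ^ Suc m * \<delta>"
      using \<delta> by (simp_all add: powr_add powr_realpow field_simps)
    have "h x powr (-s) \<le> a m"
      unfolding a_def using m' \<delta> s by (intro powr_mono2') auto
    then have "ennreal (h x powr (-s)) \<le> ennreal (a m) * indicator (E m) x"
      using m' x by (simp add: E_def ennreal_leI)
    also have "\<dots> \<le> (\<Sum>k. ennreal (a k) * indicator (E k) x)"
      using sum_le_suminf[of "\<lambda>k. ennreal (a k) * indicator (E k) x" "{m}"]
      by (simp del: sum_mult_indicator)
    finally show "ennreal (h x powr (-s)) \<le> (\<Sum>k. ennreal (a k) * indicator (E k) x)" .
  qed
  also have "\<dots> = (\<Sum>k. ennreal (a k) * emeasure M (E k))"
    by (subst nn_integral_suminf) (simp_all add: nn_integral_cmult_indicator)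
  also have "\<dots> \<le> (\<Sum>k. ennreal (A * 2 powr d * \<delta> powr (d - s) * q ^ k))"
  proof (rule suminf_le)
    fix k
    have "ennreal (a k) * emeasure M (E k) \<le> ennreal (a k) * ennreal (A * (2 ^ Suc k * \<delta>) powr d)"
      unfolding E_def using \<delta> by (intro mult_left_mono growth) auto
    also have "\<dots> = ennreal (a k * (A * (2 ^ Suc k * \<delta>) powr d))"
      using A by (simp add: a_def ennreal_mult)
    also have "a k * (A * (2 ^ Suc k * \<delta>) powr d) = A * 2 powr d * \<delta> powr (d - s) * q ^ k"
      using \<delta> unfolding a_def q_def
      by (simp add: powr_mult powr_add powr_diff powr_minus powr_powr mult.commute
          field_simps flip: powr_realpow)
    finally show "ennreal (a k) * emeasure M (E k) \<le> ennreal (A * 2 powr d * \<delta> powr (d - s) * q ^ k)" .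
  qed auto
  also have "\<dots> = ennreal (A * 2 powr d * \<delta> powr (d - s) * (1 / (1 - q)))"
    using q A by (intro suminf_ennreal_eq sums_mult geometric_sums) auto
  finally show ?thesis by (simp add: q_def mult_ac)
qed

lemma nn_integral_kernel_le:
  assumes z: "z \<in> ball 0 1" and s: "2 < s"
  shows "(\<integral>\<^sup>+w. ennreal (norm (1 - z * cnj w) powr (-s)) \<partial>disc_area)
    \<le> ennreal (16 / (1 - 2 powr (2 - s)) * (1 - norm z) powr (2 - s))"
proof -
  have "(\<integral>\<^sup>+w. ennreal (norm (1 - z * cnj w) powr (-s)) \<partial>disc_area)
    \<le> ennreal (4 * 2 powr 2 / (1 - 2 powr (2 - s)) * (1 - norm z) powr (2 - s))"
  proof (rule nn_integral_negative_powr_le)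
    show "(\<lambda>w. norm (1 - z * cnj w)) \<in> borel_measurable disc_area"
      by (intro borel_measurable_disc_area borel_measurable_continuous_onI continuous_intros)
  qed (use z s emeasure_kernel_sublevel_le[OF z] norm_one_minus_mult_cnj_ge[OF z] in auto)
  then show ?thesis by simp
qed

text \<open>Joint measurability makes \<open>K_op s f\<close> measurable by Fubini's theorem. Since \<open>f\<close> is merely Lebesgue
  measurable, the continuity argument is confined to the power of \<open>1 - z * cnj w\<close>, which takes its
  base in the right half-plane.\<close>

lemma K_integrand_measurable:
  assumes f: "f \<in> borel_measurable disc_area"
  shows "(\<lambda>(z, w). K_integrand s f z w) \<in> borel_measurable (disc_area \<Otimes>\<^sub>M disc_area)"
proof -
  let ?P = "disc_area \<Otimes>\<^sub>M disc_area"
  let ?H = "{u. 0 < Re u}"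
  have [measurable]: "(\<lambda>z. z) \<in> borel_measurable disc_area" "cnj \<in> borel_measurable disc_area"
    by (auto intro!: borel_measurable_disc_area borel_measurable_continuous_onI continuous_intros)
  have "(\<lambda>p. 1 - fst p * cnj (snd p)) \<in> ?P \<rightarrow>\<^sub>M restrict_space borel ?H"
  proof (rule measurable_restrict_space2)
    show "(\<lambda>p. 1 - fst p * cnj (snd p)) \<in> space ?P \<rightarrow> ?H"
      by (auto simp: space_pair_measure dest: Re_one_minus_mult_cnj_pos)
  qed measurable
  moreover have "(\<lambda>u. u powr complex_of_real s) \<in> borel_measurable (restrict_space borel ?H)"
    by (intro borel_measurable_continuous_on_restrict continuous_on_powr_complex continuous_intros)
       (auto simp: complex_nonpos_Reals_iff)
  ultimately have [measurable]:
      "(\<lambda>p. (1 - fst p * cnj (snd p)) powr complex_of_real s) \<in> borel_measurable ?P"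
    by (rule measurable_compose)
  have [measurable]: "(\<lambda>p. f (snd p)) \<in> borel_measurable ?P"
    using f by measurable
  show ?thesis by (simp add: K_integrand_def case_prod_beta)
qed

section \<open>Boundedness of the integral operator\<close>

text \<open>The norm is a nonnegative real because the disc has positive measure; over a null space the
  essential supremum would be \<open>-\<infinity>\<close>.\<close>

lemma Linf_AE_bound:
  assumes "f \<in> Linf disc_area"
  obtains N where "0 \<le> N" "Linf_norm disc_area f = ereal N" "AE w in disc_area. norm (f w) \<le> N"
proof -
  have [measurable]: "f \<in> borel_measurable disc_area" and fin: "Linf_norm disc_area f < \<infinity>"
    using assms by (auto simp: Linf_def)
  have "esssup disc_area (\<lambda>_. 0::ereal) \<le> Linf_norm disc_area f"
    unfolding Linf_norm_def by (rule esssup_mono) auto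
  then have "0 \<le> Linf_norm disc_area f"
    using disc_area.emeasure_space_1 by (simp add: esssup_const)
  with fin obtain N where N: "Linf_norm disc_area f = ereal N" "0 \<le> N"
    by (cases "Linf_norm disc_area f") auto
  have "AE w in disc_area. norm (f w) \<le> N"
    using esssup_AE[of "\<lambda>w. ereal (norm (f w))" disc_area] N by (simp add: Linf_norm_def)
  with N that show thesis by blast
qed

lemma K_integrand_integrable_and_bound:
  assumes f: "f \<in> borel_measurable disc_area" and N: "0 \<le> N" "AE w in disc_area. norm (f w) \<le> N"
    and z: "z \<in> ball 0 1" and s: "2 < s"
  shows "integrable disc_area (K_integrand s f z)"
    and "norm (K_op s f z) \<le> N * (16 / (1 - 2 powr (2 - s))) * (1 - norm z) powr (2 - s)"
proof -
  define B where "B = 16 / (1 - 2 powr (2 - s)) * (1 - norm z) powr (2 - s)"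
  have B: "0 \<le> B" using s by (simp add: B_def less_imp_le powr_less_one)
  have meas: "K_integrand s f z \<in> borel_measurable disc_area"
    using measurable_Pair2[OF K_integrand_measurable[OF f, of s], of z] z by simp
  have [measurable]: "(\<lambda>w. norm (1 - z * cnj w)) \<in> borel_measurable disc_area"
    by (intro borel_measurable_disc_area borel_measurable_continuous_onI continuous_intros)
  have "(\<integral>\<^sup>+w. ennreal (norm (K_integrand s f z w)) \<partial>disc_area)
      \<le> (\<integral>\<^sup>+w. ennreal N * ennreal (norm (1 - z * cnj w) powr (-s)) \<partial>disc_area)"
  proof (rule nn_integral_mono_AE)
    show "AE w in disc_area. ennreal (norm (K_integrand s f z w))
        \<le> ennreal N * ennreal (norm (1 - z * cnj w) powr (-s))"
      using N(2)
    proof eventually_elim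
      case (elim w)
      have "norm (K_integrand s f z w) = norm (f w) * norm (1 - z * cnj w) powr (-s)"
        by (simp add: K_integrand_def norm_divide norm_powr_real_powr' powr_minus_divide)
      also have "\<dots> \<le> N * norm (1 - z * cnj w) powr (-s)"
        using elim by (intro mult_right_mono) auto
      finally show ?case using N(1) by (simp add: ennreal_leI flip: ennreal_mult)
    qed
  qed
  also have "\<dots> = ennreal N * (\<integral>\<^sup>+w. ennreal (norm (1 - z * cnj w) powr (-s)) \<partial>disc_area)"
    by (rule nn_integral_cmult) measurable
  also have "\<dots> \<le> ennreal N * ennreal B"
    unfolding B_def by (intro mult_left_mono nn_integral_kernel_le z s) simp
  finally have le: "(\<integral>\<^sup>+w. ennreal (norm (K_integrand s f z w)) \<partial>disc_area) \<le> ennreal (N * B)"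
    using N(1) B by (simp add: ennreal_mult)
  then show int: "integrable disc_area (K_integrand s f z)"
    using meas by (intro integrableI_bounded) (auto simp: less_top[symmetric] top_unique intro: le_less_trans)
  have "ennreal (norm (K_op s f z)) \<le> ennreal (N * B)"
    unfolding K_op_def using integral_norm_bound_ennreal[OF int] le by (rule order_trans)
  then have "norm (K_op s f z) \<le> N * B"
    using N(1) B ennreal_le_iff[of "N * B"] by (metis mult_nonneg_nonneg)
  then show "norm (K_op s f z) \<le> N * (16 / (1 - 2 powr (2 - s))) * (1 - norm z) powr (2 - s)"
    by (simp add: B_def mult.assoc)
qed

text \<open>The bound on \<open>g\<close> confines \<open>\<bar>g\<bar> > l\<close> to a boundary strip of width \<open>\<rho>\<close> with
  \<open>\<rho> powr \<beta> = B / l\<close>. The strip has area at most \<open>2 * \<rho>\<close>, and the factor \<open>l\<close> in the weak quasi-norm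
  cancels exactly.\<close>

lemma weak_Lp_norm_le_of_boundary_growth:
  assumes \<beta>: "0 < \<beta>" and B: "0 \<le> B"
    and g: "\<And>z. z \<in> ball 0 1 \<Longrightarrow> norm (g z) \<le> B * (1 - norm z) powr (-\<beta>)"
  shows "weak_Lp_norm (1 / \<beta>) disc_area g \<le> ereal (2 powr \<beta> * B)"
  unfolding weak_Lp_norm_def
proof (rule SUP_least)
  fix l :: real assume "l \<in> {0<..}"
  then have l: "0 < l" by simp
  define \<rho> where "\<rho> = (B / l) powr (1 / \<beta>)"
  have \<rho>: "0 \<le> \<rho>" "\<rho> powr \<beta> = B / l"
    using \<beta> B l by (simp_all add: \<rho>_def powr_powr)
  have "{z \<in> space disc_area. norm (g z) > l} \<subseteq> {z \<in> ball 0 1. 1 - norm z < \<rho>}"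
  proof clarsimp
    fix z :: complex assume z: "norm z < 1" and "l < norm (g z)"
    then have "l < B * (1 - norm z) powr (-\<beta>)" using g[of z] by simp
    then have "(1 - norm z) powr \<beta> < \<rho> powr \<beta>"
      unfolding \<rho>(2) using l z by (simp add: powr_minus field_simps)
    then show "1 - norm z < \<rho>"
      using \<beta> \<rho>(1) z powr_mono2[of \<beta> \<rho> "1 - norm z"] by linarith
  qed
  moreover have "{z \<in> ball 0 1. 1 - norm z < \<rho>} \<in> sets disc_area"
    by (rule borel_imp_sets_disc_area) auto
  ultimately have "measure disc_area {z \<in> space disc_area. norm (g z) > l}
      \<le> measure disc_area {z \<in> ball 0 1. 1 - norm z < \<rho>}"
    by (rule disc_area.finite_measure_mono)
  also have "\<dots> \<le> 2 * \<rho>" by (rule measure_disc_area_boundary_strip_le) (rule \<rho>)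
  finally have "measure disc_area {z \<in> space disc_area. norm (g z) > l} powr \<beta> \<le> (2 * \<rho>) powr \<beta>"
    using \<beta> by (intro powr_mono2) auto
  also have "\<dots> = 2 powr \<beta> * B / l" using \<rho> by (simp add: powr_mult)
  finally show "ereal (l * measure disc_area {z \<in> space disc_area. norm (g z) > l} powr (1 / (1 / \<beta>)))
      \<le> ereal (2 powr \<beta> * B)"
    using l by (simp add: field_simps)
qed

theorem lemma4p1:
  fixes t :: real
  assumes "1 < t" and "t < 3 / 2"
  shows "(\<forall>f \<in> Linf disc_area. \<forall>z \<in> ball 0 1. integrable disc_area (K_integrand (2 * t) f z)) \<and>
    bounded_operator disc_area
      (Linf disc_area) (Linf_norm disc_area)
      (weak_Lp (1 / (2 * t - 2)) disc_area) (weak_Lp_norm (1 / (2 * t - 2)) disc_area)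
      (K_op (2 * t))"
proof -
  define s where "s = 2 * t"
  define C where "C = 16 / (1 - 2 powr (2 - s))"
  define D where "D = 2 powr (s - 2) * C"
  have s: "2 < s" using assms by (simp add: s_def)
  then have C: "0 \<le> C" by (simp add: C_def less_imp_le powr_less_one)
  have int: "integrable disc_area (K_integrand s f z)" if "f \<in> Linf disc_area" "z \<in> ball 0 1" for f z
    using that(1)
  proof (rule Linf_AE_bound)
    fix N assume "0 \<le> N" "AE w in disc_area. norm (f w) \<le> N"
    then show ?thesis
      using K_integrand_integrable_and_bound(1)[of f N z s] that s by (auto simp: Linf_def)
  qed
  have bound: "weak_Lp_norm (1 / (s - 2)) disc_area (K_op s f) \<le> ereal D * Linf_norm disc_area f"
    if f: "f \<in> Linf disc_area" for f
    using f
  proof (rule Linf_AE_bound)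
    fix N assume N: "0 \<le> N" "Linf_norm disc_area f = ereal N" "AE w in disc_area. norm (f w) \<le> N"
    have "weak_Lp_norm (1 / (s - 2)) disc_area (K_op s f) \<le> ereal (2 powr (s - 2) * (N * C))"
    proof (rule weak_Lp_norm_le_of_boundary_growth)
      show "norm (K_op s f z) \<le> N * C * (1 - norm z) powr (- (s - 2))" if "z \<in> ball 0 1" for z
        using K_integrand_integrable_and_bound(2)[of f N z s] N f that s by (simp add: Linf_def C_def)
    qed (use s N C in auto)
    then show ?thesis by (simp add: N D_def mult_ac)
  qed
  have mem: "K_op s f \<in> weak_Lp (1 / (s - 2)) disc_area" if f: "f \<in> Linf disc_area" for f
  proof -
    have "(\<lambda>(z, w). K_integrand s f z w) \<in> borel_measurable (disc_area \<Otimes>\<^sub>M disc_area)"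
      using f by (intro K_integrand_measurable) (simp add: Linf_def)
    then have "K_op s f \<in> borel_measurable disc_area"
      unfolding K_op_def by (rule disc_area.borel_measurable_lebesgue_integral)
    moreover have "weak_Lp_norm (1 / (s - 2)) disc_area (K_op s f) < \<infinity>"
      using f
    proof (rule Linf_AE_bound)
      fix N assume "Linf_norm disc_area f = ereal N"
      then have "weak_Lp_norm (1 / (s - 2)) disc_area (K_op s f) \<le> ereal (D * N)"
        using bound[OF f] by simp
      then show ?thesis by (rule le_less_trans) simp
    qed
    ultimately show ?thesis by (simp add: weak_Lp_def)
  qed
  have add: "K_op s (\<lambda>y. f y + g y) z = K_op s f z + K_op s g z"
    if "f \<in> Linf disc_area" "g \<in> Linf disc_area" "z \<in> ball 0 1" for f g z
    using Bochner_Integration.integral_add[OF int[OF that(1,3)] int[OF that(2,3)]]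
    by (simp add: K_op_def K_integrand_def[abs_def] add_divide_distrib)
  have scale: "K_op s (\<lambda>y. c * f y) z = c * K_op s f z" for c f z
    by (simp add: K_op_def K_integrand_def flip: integral_mult_right_zero)
  have "0 \<le> D" using C by (simp add: D_def)
  then have "bounded_operator disc_area (Linf disc_area) (Linf_norm disc_area)
      (weak_Lp (1 / (s - 2)) disc_area) (weak_Lp_norm (1 / (s - 2)) disc_area) (K_op s)"
    unfolding bounded_operator_def using mem bound add scale by (auto intro!: AE_I2)
  then show ?thesis using int by (simp add: s_def)
qed

end
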